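(* Let $G=(V,E,L,\ell)$ be an edge-labeled hypergraph, let $d_{\mathit{max}}$ be the largest number of hyperedges that any node participates in, and for $v\in V$ let $\mathcal{M}_v=\operatorname{argmin}_{c\in L}d_v^c\subseteq L$ be the set of all colors minimizing the color degree of $v$. For every $\beta>d_{\mathit{max}}$, any optimal solution $\{x_e,x_v^c\}$ to the LP relaxation of the diversity-regularized categorical edge clustering (DRCEC) integer linear program with parameter $\beta$ satisfies $$\sum_{c\in\mathcal{M}_v}(1-x_v^c)=1\quad\text{for every } v\in V.$$ Consequently, the rounded solution returned by Algorithm 1 is a minority vote clustering, where Algorithm 1 computes an optimal solution of this LP relaxation and then assigns each $v\in V$ to any color $c\in\operatorname{argmin}_{j\in L}x_v^j$.
   Context: $G=(V,E,L,\ell)$ is a finite hypergraph with labeled hyperedges: $V$ is the node set, $E$ the set of hyperedges, $L=\{1,\dots,k\}$ the set of labels ("colors"), and $\ell\colon E\to L$ assigns a color to each hyperedge. $E_c\subseteq E$ is the set of hyperedges of color $c$. For $v\in V$, $c\in L$, the color degree $d_v^c$ is the number of hyperedges of color $c$ that contain $v$; $d_{\mathit{max}}=\max_{v\in V}\sum_{c\in L}d_v^c$. A clustering assigns each node to exactly one color in $L$. A minority vote clustering is one in which each node $v$ is assigned a color in $\operatorname{argmin}_{c\in L}d_v^c$ (ties broken arbitrarily). The DRCEC integer linear program with parameter $\beta\ge 0$ is $$\min\ \sum_{c\in L}\sum_{e\in E_c}x_e+\beta\sum_{v\in V}\sum_{c\in L}d_v^c(1-x_v^c)$$ subject to: $\sum_{c=1}^k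 x_v^c=k-1$ for all $v\in V$; $x_v^c\le x_e$ for all $c\in L$, $e\in E_c$, $v\in e$; and $x_v^c,x_e\in\{0,1\}$ for all $c\in L$, $v\in V$, $e\in E$. Its LP relaxation is obtained by replacing $x_v^c,x_e\in\{0,1\}$ with $x_v^c,x_e\in[0,1]$. *)

theory Defs
  imports Complex_Main
begin

(* Hyperedges are named by elements of E, with nd e the set of nodes of e ("v \<in> e" reads
   v \<in> nd e); so parallel hyperedges, e.g. of different colors, are allowed.
   Hypergraphs with E \<subseteq> Pow V are the case nd = id. *)
locale labeled_hypergraph =
  fixes V :: "'v set" and E :: "'e set" and nd :: "'e \<Rightarrow> 'v set"
    and k :: nat and l :: "'e \<Rightarrow> nat"
  assumes finite_V: "finite V"
    and finite_E: "finite E"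
    and nodes: "\<And>e. e \<in> E \<Longrightarrow> nd e \<subseteq> V"
    and labels: "\<And>e. e \<in> E \<Longrightarrow> l e \<in> {1..k}"

definition color_edges :: "'e set \<Rightarrow> ('e \<Rightarrow> nat) \<Rightarrow> nat \<Rightarrow> 'e set" where
  "color_edges E l c = {e \<in> E. l e = c}"

definition color_degree :: "'e set \<Rightarrow> ('e \<Rightarrow> 'v set) \<Rightarrow> ('e \<Rightarrow> nat) \<Rightarrow> 'v \<Rightarrow> nat \<Rightarrow> nat" where
  "color_degree E nd l v c = card {e \<in> color_edges E l c. v \<in> nd e}"

(* Unspecified for V = {}, where all statements about nodes are vacuous. *)
definition max_degree :: "'v set \<Rightarrow> 'e set \<Rightarrow> ('e \<Rightarrow> 'v set) \<Rightarrow> nat \<Rightarrow> ('e \<Rightarrow> nat) \<Rightarrow> nat" where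
  "max_degree V E nd k l = Max ((\<lambda>v. \<Sum>c\<in>{1..k}. color_degree E nd l v c) ` V)"

definition argmin_colors :: "nat \<Rightarrow> (nat \<Rightarrow> 'a::order) \<Rightarrow> nat set" where
  "argmin_colors k f = {c. is_arg_min f (\<lambda>j. j \<in> {1..k}) c}"

definition minority_colors :: "'e set \<Rightarrow> ('e \<Rightarrow> 'v set) \<Rightarrow> nat \<Rightarrow> ('e \<Rightarrow> nat) \<Rightarrow> 'v \<Rightarrow> nat set" where
  "minority_colors E nd k l v = argmin_colors k (color_degree E nd l v)"

definition clustering :: "'v set \<Rightarrow> nat \<Rightarrow> ('v \<Rightarrow> nat) \<Rightarrow> bool" where
  "clustering V k C \<longleftrightarrow> (\<forall>v\<in>V. C v \<in> {1..k})"

definition minority_vote_clustering ::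
  "'v set \<Rightarrow> 'e set \<Rightarrow> ('e \<Rightarrow> 'v set) \<Rightarrow> nat \<Rightarrow> ('e \<Rightarrow> nat) \<Rightarrow> ('v \<Rightarrow> nat) \<Rightarrow> bool" where
  "minority_vote_clustering V E nd k l C \<longleftrightarrow>
     clustering V k C \<and> (\<forall>v\<in>V. C v \<in> minority_colors E nd k l v)"

(* In the programs below, xE e is the variable x_e and xV v c is x_v^c.
   Only the values for e in E, v in V and c in {1..k} matter. *)

definition drcec_objective ::
  "'v set \<Rightarrow> 'e set \<Rightarrow> ('e \<Rightarrow> 'v set) \<Rightarrow> nat \<Rightarrow> ('e \<Rightarrow> nat) \<Rightarrow> real
    \<Rightarrow> ('e \<Rightarrow> real) \<Rightarrow> ('v \<Rightarrow> nat \<Rightarrow> real) \<Rightarrow> real" where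
  "drcec_objective V E nd k l \<beta> xE xV =
     (\<Sum>c\<in>{1..k}. \<Sum>e\<in>color_edges E l c. xE e)
     + \<beta> * (\<Sum>v\<in>V. \<Sum>c\<in>{1..k}. real (color_degree E nd l v c) * (1 - xV v c))"

(* D is the domain of the variables: {0, 1} for the integer program,
   {0..1} for its LP relaxation. *)
definition drcec_feasible ::
  "real set \<Rightarrow> 'v set \<Rightarrow> 'e set \<Rightarrow> ('e \<Rightarrow> 'v set) \<Rightarrow> nat \<Rightarrow> ('e \<Rightarrow> nat)
    \<Rightarrow> ('e \<Rightarrow> real) \<Rightarrow> ('v \<Rightarrow> nat \<Rightarrow> real) \<Rightarrow> bool" where
  "drcec_feasible D V E nd k l xE xV \<longleftrightarrow>
     (\<forall>v\<in>V. (\<Sum>c\<in>{1..k}. xV v c) = real k - 1) \<and>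
     (\<forall>c\<in>{1..k}. \<forall>e\<in>color_edges E l c. \<forall>v\<in>nd e. xV v c \<le> xE e) \<and>
     (\<forall>v\<in>V. \<forall>c\<in>{1..k}. xV v c \<in> D) \<and>
     (\<forall>e\<in>E. xE e \<in> D)"

definition drcec_optimal ::
  "real set \<Rightarrow> 'v set \<Rightarrow> 'e set \<Rightarrow> ('e \<Rightarrow> 'v set) \<Rightarrow> nat \<Rightarrow> ('e \<Rightarrow> nat) \<Rightarrow> real
    \<Rightarrow> ('e \<Rightarrow> real) \<Rightarrow> ('v \<Rightarrow> nat \<Rightarrow> real) \<Rightarrow> bool" where
  "drcec_optimal D V E nd k l \<beta> xE xV \<longleftrightarrow>
     drcec_feasible D V E nd k l xE xV \<and>
     (\<forall>yE yV. drcec_feasible D V E nd k l yE yV \<longrightarrow>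
        drcec_objective V E nd k l \<beta> xE xV \<le> drcec_objective V E nd k l \<beta> yE yV)"

abbreviation drcec_ilp_optimal ::
  "'v set \<Rightarrow> 'e set \<Rightarrow> ('e \<Rightarrow> 'v set) \<Rightarrow> nat \<Rightarrow> ('e \<Rightarrow> nat) \<Rightarrow> real
    \<Rightarrow> ('e \<Rightarrow> real) \<Rightarrow> ('v \<Rightarrow> nat \<Rightarrow> real) \<Rightarrow> bool" where
  "drcec_ilp_optimal \<equiv> drcec_optimal {0, 1}"

abbreviation drcec_lp_optimal ::
  "'v set \<Rightarrow> 'e set \<Rightarrow> ('e \<Rightarrow> 'v set) \<Rightarrow> nat \<Rightarrow> ('e \<Rightarrow> nat) \<Rightarrow> real
    \<Rightarrow> ('e \<Rightarrow> real) \<Rightarrow> ('v \<Rightarrow> nat \<Rightarrow> real) \<Rightarrow> bool" where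
  "drcec_lp_optimal \<equiv> drcec_optimal {0..1}"

(* The rounding algorithm is nondeterministic (choice of the optimal LP solution,
   tie breaking), so it is given by the relation "C is a possible output". *)
definition lp_rounding_output ::
  "'v set \<Rightarrow> 'e set \<Rightarrow> ('e \<Rightarrow> 'v set) \<Rightarrow> nat \<Rightarrow> ('e \<Rightarrow> nat) \<Rightarrow> real \<Rightarrow> ('v \<Rightarrow> nat) \<Rightarrow> bool" where
  "lp_rounding_output V E nd k l \<beta> C \<longleftrightarrow>
     (\<exists>xE xV. drcec_lp_optimal V E nd k l \<beta> xE xV \<and>
        (\<forall>v\<in>V. C v \<in> argmin_colors k (xV v)))"

end

(* If an optimal LP solution gave a color c outside M_v the positive weight \<delta> = 1 - x_v^c at v,
   one could move \<delta> to a minority color m. Raising x_e to 1 on the edges of color c at v restores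
   feasibility, and since x_e \<ge> x_v^c it costs at most d_v^c \<delta> \<le> d_max \<delta>. The color degrees are
   integers, so the regularizer drops by \<beta> (d_v^c - d_v^m) \<delta> \<ge> \<beta> \<delta> > d_max \<delta>, a contradiction.
   Hence x_v^c = 1 for every c outside M_v. *)
theory Submission
  imports Defs
begin

lemma argmin_colors_iff:
  fixes f :: "nat \<Rightarrow> 'a::linorder"
  shows "c \<in> argmin_colors k f \<longleftrightarrow> c \<in> {1..k} \<and> (\<forall>j\<in>{1..k}. f c \<le> f j)"
  by (auto simp: argmin_colors_def is_arg_min_linorder)

lemma argmin_colors_nonempty:
  fixes f :: "nat \<Rightarrow> 'a::linorder"
  assumes "k \<ge> 1"
  shows "argmin_colors k f \<noteq> {}"
proof -
  have "finite {1..k}" "{1..k} \<noteq> {}" using assms by auto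
  then obtain c where "is_arg_min f (\<lambda>j. j \<in> {1..k}) c"
    using ex_is_arg_min_if_finite by blast
  then show ?thesis by (auto simp: argmin_colors_def)
qed

lemma sum_fun_upd:
  fixes f :: "'a \<Rightarrow> 'b::ab_group_add"
  assumes "finite A" "a \<in> A"
  shows "sum (f(a := b)) A = sum f A + (b - f a)"
proof -
  have "sum (f(a := b)) (A - {a}) = sum f (A - {a})"
    by (intro sum.cong) auto
  then show ?thesis
    using assms by (simp add: sum.remove[of A a])
qed

lemma sum_fun_upd2:
  fixes f :: "'a \<Rightarrow> 'b::ab_group_add"
  assumes "finite A" "a \<in> A" "b \<in> A" "a \<noteq> b"
  shows "sum (f(a := s, b := t)) A = sum f A + (s - f a) + (t - f b)"
  using assms by (simp add: sum_fun_upd fun_upd_other del: fun_upd_apply)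

context labeled_hypergraph
begin

lemma finite_color_edges [simp]: "finite (color_edges E l c)"
  using finite_E by (simp add: color_edges_def)

lemma color_degree_le_max_degree:
  assumes "v \<in> V" "c \<in> {1..k}"
  shows "color_degree E nd l v c \<le> max_degree V E nd k l"
proof -
  have "color_degree E nd l v c \<le> (\<Sum>c\<in>{1..k}. color_degree E nd l v c)"
    using assms(2) by (intro member_le_sum) auto
  also have "\<dots> \<le> max_degree V E nd k l"
    unfolding max_degree_def using assms(1) finite_V by (intro Max_ge) auto
  finally show ?thesis .
qed

text \<open>Only the hyperedges of color \<open>c\<close> at \<open>v\<close> change. Each rises by
  \<open>1 - xE e\<close>, which the constraint \<open>xV v c \<le> xE e\<close> bounds by
  \<open>1 - xV v c\<close>, and there are \<open>color_degree E nd l v c\<close> of them.\<close>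

lemma sum_edges_raise_le:
  fixes v :: 'v
  assumes feas: "drcec_feasible {0..1} V E nd k l xE xV" and c: "c \<in> {1..k}"
  defines "yE \<equiv> \<lambda>e. if l e = c \<and> v \<in> nd e then 1 else xE e"
  shows "(\<Sum>j\<in>{1..k}. \<Sum>e\<in>color_edges E l j. yE e)
       \<le> (\<Sum>j\<in>{1..k}. \<Sum>e\<in>color_edges E l j. xE e)
         + real (color_degree E nd l v c) * (1 - xV v c)"
proof -
  let ?S = "\<lambda>z j. \<Sum>e\<in>color_edges E l j. z e"
  have "?S yE c \<le> (\<Sum>e\<in>color_edges E l c. xE e + (if v \<in> nd e then 1 - xV v c else 0))"
    using feas c by (intro sum_mono) (auto simp: yE_def drcec_feasible_def color_edges_def)
  also have "\<dots> = ?S xE c + real (color_degree E nd l v c) * (1 - xV v c)"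
    by (simp add: sum.distrib color_degree_def flip: sum.inter_filter)
  finally have at_c: "?S yE c \<le> ?S xE c + real (color_degree E nd l v c) * (1 - xV v c)" .
  have "(\<Sum>j\<in>{1..k} - {c}. ?S yE j) = (\<Sum>j\<in>{1..k} - {c}. ?S xE j)"
    by (intro sum.cong) (auto simp: yE_def color_edges_def)
  with at_c show ?thesis
    using c by (simp add: sum.remove[of "{1..k}" c] del: One_nat_def)
qed

lemma drcec_lp_optimal_nonminority_eq_1:
  assumes \<beta>: "\<beta> > real (max_degree V E nd k l)"
    and opt: "drcec_lp_optimal V E nd k l \<beta> xE xV"
    and v: "v \<in> V" and c: "c \<in> {1..k}" and nonmin: "c \<notin> minority_colors E nd k l v"
  shows "xV v c = 1"
proof (rule ccontr)
  assume "xV v c \<noteq> 1"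
  define d where "d = color_degree E nd l v"
  define \<delta> where "\<delta> = 1 - xV v c"
  have feas: "drcec_feasible {0..1} V E nd k l xE xV"
    using opt by (simp add: drcec_optimal_def)
  then have x01: "\<And>u j. u \<in> V \<Longrightarrow> j \<in> {1..k} \<Longrightarrow> 0 \<le> xV u j \<and> xV u j \<le> 1"
    and sum_x: "\<And>u. u \<in> V \<Longrightarrow> (\<Sum>j\<in>{1..k}. xV u j) = real k - 1"
    by (auto simp: drcec_feasible_def)
  have \<delta>: "\<delta> > 0"
    using x01[OF v c] \<open>xV v c \<noteq> 1\<close> by (simp add: \<delta>_def)
  obtain m where m: "m \<in> argmin_colors k d"
    using argmin_colors_nonempty[of k d] c by auto
  \<comment> \<open>The inequality is strict because \<open>d c \<le> d m\<close> would make
    \<open>c\<close> a minimizer too.\<close>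
  have mk: "m \<in> {1..k}" and mc: "m \<noteq> c" and dmc: "d m < d c"
    using m nonmin c by (auto simp: argmin_colors_iff minority_colors_def d_def
        intro: leI order_trans)
  define yE where "yE = (\<lambda>e. if l e = c \<and> v \<in> nd e then 1 else xE e)"
  \<comment> \<open>Since \<open>1 = xV v c + \<delta>\<close>, the two changes cancel in the sum
    over the colors at \<open>v\<close>.\<close>
  define yV where "yV = xV(v := (xV v)(m := xV v m - \<delta>, c := 1))"
  \<comment> \<open>The weights \<open>1 - xV v j\<close> are nonnegative with total 1, so those of
    \<open>m\<close> and \<open>c\<close> together are at most 1. Hence lowering
    \<open>xV v m\<close> by \<delta> keeps it nonnegative.\<close>
  have "(\<Sum>j\<in>{m, c}. 1 - xV v j) \<le> (\<Sum>j\<in>{1..k}. 1 - xV v j)"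
    using mk c x01[OF v] by (intro sum_mono2) auto
  then have m_ge: "\<delta> \<le> xV v m"
    using mc sum_x[OF v] by (simp add: sum_subtractf \<delta>_def)
  have "(\<Sum>j\<in>{1..k}. yV u j) = real k - 1" if "u \<in> V" for u
    using sum_x[OF that] mk c mc
    by (cases "u = v")
      (simp_all add: yV_def \<delta>_def sum_fun_upd2 fun_upd_same fun_upd_other del: fun_upd_apply)
  \<comment> \<open>The only node variable that grows is the one of \<open>v\<close> and
    \<open>c\<close>, and every hyperedge of color \<open>c\<close> at \<open>v\<close> now has
    value 1, the upper bound of all node variables.\<close>
  moreover have "yV u j \<le> yE e"
    if "j \<in> {1..k}" "e \<in> color_edges E l j" "u \<in> nd e" for u j e
    using that feas mc \<delta> nodes x01
    by (fastforce simp: yV_def yE_def drcec_feasible_def color_edges_def)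
  moreover have "yV u j \<in> {0..1}" if "u \<in> V" "j \<in> {1..k}" for u j
    using x01[OF that] m_ge \<delta> x01[OF v mk] by (auto simp: yV_def)
  moreover have "yE e \<in> {0..1}" if "e \<in> E" for e
    using feas that by (auto simp: yE_def drcec_feasible_def)
  ultimately have "drcec_feasible {0..1} V E nd k l yE yV"
    by (simp add: drcec_feasible_def)
  then have le: "drcec_objective V E nd k l \<beta> xE xV \<le> drcec_objective V E nd k l \<beta> yE yV"
    using opt by (simp add: drcec_optimal_def)
  \<comment> \<open>The regularizer without its factor \<beta>. It changes only in the summand of
    \<open>v\<close>, where \<open>m\<close> gains \<open>d m * \<delta>\<close> and
    \<open>c\<close> loses \<open>d c * \<delta>\<close>.\<close>
  define R where "R z = (\<Sum>u\<in>V. \<Sum>j\<in>{1..k}. real (color_degree E nd l u j) * (1 - z u j))" for z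
  have "(\<Sum>j\<in>{1..k}. real (d j) * (1 - yV v j))
      = sum ((\<lambda>j. real (d j) * (1 - xV v j))
          (m := real (d m) * (1 - xV v m + \<delta>), c := 0)) {1..k}"
    using mc by (intro sum.cong) (auto simp: yV_def)
  also have "\<dots> = (\<Sum>j\<in>{1..k}. real (d j) * (1 - xV v j)) - (real (d c) - real (d m)) * \<delta>"
    using mk c mc by (subst sum_fun_upd2) (auto simp: \<delta>_def algebra_simps)
  finally have at_v: "(\<Sum>j\<in>{1..k}. real (d j) * (1 - yV v j))
      = (\<Sum>j\<in>{1..k}. real (d j) * (1 - xV v j)) - (real (d c) - real (d m)) * \<delta>" .
  have "(\<Sum>u\<in>V - {v}. \<Sum>j\<in>{1..k}. real (color_degree E nd l u j) * (1 - yV u j))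
      = (\<Sum>u\<in>V - {v}. \<Sum>j\<in>{1..k}. real (color_degree E nd l u j) * (1 - xV u j))"
    by (intro sum.cong) (auto simp: yV_def)
  with at_v have R_eq: "R yV = R xV - (real (d c) - real (d m)) * \<delta>"
    using v finite_V by (simp add: R_def d_def sum.remove[of V v])
  have "0 \<le> \<beta>"
    using \<beta> by linarith
  \<comment> \<open>Integrality enters here: distinct color degrees differ by at least 1.\<close>
  have "1 * \<delta> \<le> (real (d c) - real (d m)) * \<delta>"
    using dmc \<delta> by (intro mult_right_mono) auto
  then have "\<beta> * \<delta> \<le> \<beta> * (R xV - R yV)"
    using R_eq \<open>0 \<le> \<beta>\<close> by (intro mult_left_mono) auto
  \<comment> \<open>By optimality, the saving in the regularizer cannot exceed the increase of the
    edge cost.\<close>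
  also have "\<dots> \<le> real (d c) * \<delta>"
    using le sum_edges_raise_le[OF feas c, of v]
    by (simp add: drcec_objective_def R_def yE_def d_def \<delta>_def algebra_simps)
  also have "\<dots> \<le> real (max_degree V E nd k l) * \<delta>"
    using color_degree_le_max_degree[OF v c] \<delta> by (simp add: d_def)
  also have "\<dots> < \<beta> * \<delta>"
    using \<beta> \<delta> by simp
  finally show False by simp
qed

text \<open>Colors outside the minority set contribute 0, so the sum may run over all colors, where
  the equality constraint gives \<open>k - (k - 1)\<close>.\<close>

lemma drcec_lp_optimal_sum_minority:
  assumes \<beta>: "\<beta> > real (max_degree V E nd k l)"
    and opt: "drcec_lp_optimal V E nd k l \<beta> xE xV"
    and v: "v \<in> V"
  shows "(\<Sum>c\<in>minority_colors E nd k l v. 1 - xV v c) = 1"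
proof -
  have "(\<Sum>c\<in>minority_colors E nd k l v. 1 - xV v c) = (\<Sum>c\<in>{1..k}. 1 - xV v c)"
    using drcec_lp_optimal_nonminority_eq_1[OF assms]
    by (intro sum.mono_neutral_left) (auto simp: minority_colors_def argmin_colors_iff)
  also have "\<dots> = 1"
    using opt v by (simp add: sum_subtractf drcec_optimal_def drcec_feasible_def)
  finally show ?thesis .
qed

text \<open>If \<open>C v\<close> were not a minority color, then \<open>xV v (C v) = 1\<close>. As
  \<open>C v\<close> minimizes \<open>xV v\<close>, every \<open>xV v j\<close> would be at least 1,
  so the minority weights could not sum to 1.\<close>

lemma lp_rounding_output_minority_vote:
  assumes \<beta>: "\<beta> > real (max_degree V E nd k l)"
    and out: "lp_rounding_output V E nd k l \<beta> C"
  shows "minority_vote_clustering V E nd k l C"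
proof -
  obtain xE xV where opt: "drcec_lp_optimal V E nd k l \<beta> xE xV"
    and C: "\<And>v. v \<in> V \<Longrightarrow> C v \<in> argmin_colors k (xV v)"
    using out by (auto simp: lp_rounding_output_def)
  have "C v \<in> minority_colors E nd k l v" if v: "v \<in> V" for v
  proof (rule ccontr)
    assume "C v \<notin> minority_colors E nd k l v"
    then have "xV v (C v) = 1"
      using drcec_lp_optimal_nonminority_eq_1[OF \<beta> opt v] C[OF v]
      by (simp add: argmin_colors_iff)
    then have "(\<Sum>c\<in>minority_colors E nd k l v. 1 - xV v c) \<le> 0"
      using C[OF v] by (intro sum_nonpos) (auto simp: minority_colors_def argmin_colors_iff)
    then show False
      using drcec_lp_optimal_sum_minority[OF \<beta> opt v] by simp
  qed
  then show ?thesis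
    using C by (simp add: minority_vote_clustering_def clustering_def argmin_colors_iff)
qed

end

theorem theorem5:
  fixes V :: "'v set" and E :: "'e set" and nd :: "'e \<Rightarrow> 'v set"
    and k :: nat and l :: "'e \<Rightarrow> nat" and \<beta> :: real
  assumes "labeled_hypergraph V E nd k l"
    and "\<beta> > real (max_degree V E nd k l)"
  shows "(\<forall>xE xV. drcec_lp_optimal V E nd k l \<beta> xE xV \<longrightarrow>
            (\<forall>v\<in>V. (\<Sum>c\<in>minority_colors E nd k l v. 1 - xV v c) = 1))
       \<and> (\<forall>C. lp_rounding_output V E nd k l \<beta> C \<longrightarrow> minority_vote_clustering V E nd k l C)"
  using labeled_hypergraph.drcec_lp_optimal_sum_minority[OF assms]
    labeled_hypergraph.lp_rounding_output_minority_vote[OF assms] by blast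

end
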